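(* Let $d\ge 1$ and let $w=(w_{I,\sigma})_{(I,\sigma)\in\mathcal G_d}$ be a witness weight system. Then the complete signed tail family $\lambda=(\lambda_{J,\tau})$ induced by $w$ is given by $$\lambda_{J,\tau}=\sum_{I\supseteq J}\ \sum_{\sigma\in\{\mathrm L,\mathrm U\}^I:\ \sigma|_J=\tau} w_{I,\sigma},\qquad \emptyset\neq J\subseteq[d],\ \tau\in\{\mathrm L,\mathrm U\}^J.$$ In matrix form, $\lambda=Aw$, where the matrix $A$ has entries $$A_{(J,\tau),(I,\sigma)}=\mathbf 1\{J\subseteq I,\ \sigma|_J=\tau\}.$$ In particular, the map $w\mapsto\lambda$ is linear and independent of the geometric scale $p_0$.
   Context: $[d]=\{1,\dots,d\}$. For a finite set $I$, $\{\mathrm L,\mathrm U\}^I$ is the set of functions (sign patterns) $\sigma:I\to\{\mathrm L,\mathrm U\}$. The generator index set is $\mathcal G_d=\{(I,\sigma):\emptyset\ne I\subseteq[d],\ \sigma\in\{\mathrm L,\mathrm U\}^I\}$. A witness weight system is a family $w=(w_{I,\sigma})_{(I,\sigma)\in\mathcal G_d}$ of reals $w_{I,\sigma}\ge 0$. The signed tail signature of a generator $(I,\sigma)\in\mathcal G_d$ is $\eta^{(I,\sigma)}_{J,\tau}=\mathbf 1\{J\subseteq I,\ \sigma|_J=\tau\}$ for $\emptyset\ne J\subseteq[d]$, $\tau\in\{\mathrm L,\mathrm U\}^J$. The complete signed tail family induced by $w$ is the weighted superposition of the signatures: $\lambda_{J,\tau}=\sum_{(I,\sigma)\in\mathcal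 G_d}w_{I,\sigma}\,\eta^{(I,\sigma)}_{J,\tau}$. The geometric scale $p_0\in(0,1/2)$ is the threshold used to realize the weights geometrically on $[0,1]^d$ (each noncentral generator $(I,\sigma)$ receiving mass $p_0w_{I,\sigma}$). *)

theory Defs
  imports "HOL-Probability.Probability" "HOL-Library.Function_Algebras"
begin

datatype side = L | U

text \<open>
  A generator is a pair \<open>(I, \<sigma>)\<close>; a sign pattern on \<open>I\<close> is represented by the unique function
  that is extensional on \<open>I\<close>, so that \<open>\<sigma>|\<^sub>J\<close> is \<^term>\<open>restrict \<sigma> J\<close> and equality
  of patterns is equality of functions.
\<close>

type_synonym gen = "nat set \<times> (nat \<Rightarrow> side)"

definition sign_patterns :: "nat set \<Rightarrow> (nat \<Rightarrow> side) set" where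
  "sign_patterns I = I \<rightarrow>\<^sub>E UNIV"

definition generators :: "nat \<Rightarrow> gen set" where
  "generators d = (SIGMA I : {I. I \<noteq> {} \<and> I \<subseteq> {1..d}}. sign_patterns I)"

text \<open>Only the values of a weight system (or of a tail family) on \<^term>\<open>generators d\<close> are
  meaningful.\<close>

definition weight_system :: "nat \<Rightarrow> (gen \<Rightarrow> real) \<Rightarrow> bool" where
  "weight_system d w \<longleftrightarrow> (\<forall>g\<in>generators d. 0 \<le> w g)"

definition signature :: "gen \<Rightarrow> gen \<Rightarrow> real" where
  "signature = (\<lambda>(I, \<sigma>) (J, \<tau>). of_bool (J \<subseteq> I \<and> restrict \<sigma> J = \<tau>))"

definition tail_family :: "nat \<Rightarrow> (gen \<Rightarrow> real) \<Rightarrow> gen \<Rightarrow> real" where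
  "tail_family d w = (\<lambda>h. \<Sum>g\<in>generators d. w g * signature g h)"

text \<open>Matrices with rows and columns indexed by generators; the row index comes first.\<close>

definition incidence_matrix :: "gen \<Rightarrow> gen \<Rightarrow> real" where
  "incidence_matrix = (\<lambda>(J, \<tau>) (I, \<sigma>). of_bool (J \<subseteq> I \<and> restrict \<sigma> J = \<tau>))"

definition mat_vec :: "nat \<Rightarrow> (gen \<Rightarrow> gen \<Rightarrow> real) \<Rightarrow> (gen \<Rightarrow> real) \<Rightarrow> gen \<Rightarrow> real" where
  "mat_vec d A v = (\<lambda>r. \<Sum>c\<in>generators d. A r c * v c)"

definition cube :: "nat \<Rightarrow> (nat \<Rightarrow> real) measure" where
  "cube d = (\<Pi>\<^sub>M i\<in>{1..d}. restrict_space borel {0..1})"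

text \<open>
  The \<open>(J, \<tau>)\<close>-tail region at threshold \<open>p\<close> constrains the coordinates in \<open>J\<close> only.  The cell of a
  generator \<open>(I, \<sigma>)\<close> additionally forces all coordinates outside \<open>I\<close> into the central range; for
  \<open>0 < p < 1/2\<close> these cells partition the cube minus the central box.
\<close>

definition tail_region :: "nat \<Rightarrow> real \<Rightarrow> gen \<Rightarrow> (nat \<Rightarrow> real) set" where
  "tail_region d p = (\<lambda>(J, \<tau>).
     {x \<in> space (cube d). \<forall>j\<in>J. case \<tau> j of L \<Rightarrow> x j \<le> p | U \<Rightarrow> 1 - p \<le> x j})"

definition cell :: "nat \<Rightarrow> real \<Rightarrow> gen \<Rightarrow> (nat \<Rightarrow> real) set" where
  "cell d p = (\<lambda>(I, \<sigma>).
     {x \<in> tail_region d p (I, \<sigma>). \<forall>i\<in>{1..d} - I. p < x i \<and> x i < 1 - p})"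

text \<open>
  A geometric realization of \<open>w\<close> at scale \<open>p\<close> gives each noncentral generator the mass \<open>p w\<close>.  The
  mass of the central box and the distribution inside the cells are left free.
\<close>

definition realizes :: "nat \<Rightarrow> real \<Rightarrow> (gen \<Rightarrow> real) \<Rightarrow> (nat \<Rightarrow> real) measure \<Rightarrow> bool" where
  "realizes d p w M \<longleftrightarrow>
     finite_measure M \<and> sets M = sets (cube d) \<and>
     (\<forall>g\<in>generators d. measure M (cell d p g) = p * w g)"

lemma finite_generators: "finite (generators d)"
  unfolding generators_def sign_patterns_def
proof (rule finite_SigmaI)
  show "finite {I. I \<noteq> {} \<and> I \<subseteq> {1..d}}"
    by (rule finite_subset[of _ "Pow {1..d}"]) auto
  have "finite (UNIV :: side set)"
    by (rule finite_subset[of _ "{L, U}"]) (auto intro: side.exhaust)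
  then show "finite (I \<rightarrow>\<^sub>E (UNIV :: side set))" if "I \<in> {I. I \<noteq> {} \<and> I \<subseteq> {1..d}}" for I
    using that by (intro finite_PiE) (auto intro: finite_subset)
qed

lemma space_cube: "space (cube d) = {1..d} \<rightarrow>\<^sub>E {0..1}"
  by (simp add: cube_def space_PiM)

lemma coord_measurable:
  assumes "i \<in> {1..d}" shows "(\<lambda>x. x i) \<in> borel_measurable (cube d)"
proof -
  have "(\<lambda>x. x i) \<in> cube d \<rightarrow>\<^sub>M restrict_space borel {0..1}"
    unfolding cube_def by (rule measurable_component_singleton[OF assms])
  then show ?thesis
    by (simp add: measurable_restrict_space2_iff)
qed

lemma tail_region_sets:
  assumes "h \<in> generators d" shows "tail_region d p h \<in> sets (cube d)"
proof -
  obtain J \<tau> where h: "h = (J, \<tau>)" by (cases h)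
  then have J: "J \<subseteq> {1..d}" "finite J"
    using assms by (auto simp: generators_def intro: finite_subset)
  have "{x \<in> space (cube d). case \<tau> j of L \<Rightarrow> x j \<le> p | U \<Rightarrow> 1 - p \<le> x j} \<in> sets (cube d)"
    if "j \<in> J" for j
    using coord_measurable[of j d] J that
    by (cases "\<tau> j") (auto)
  then have "{x \<in> space (cube d). \<forall>j\<in>J. case \<tau> j of L \<Rightarrow> x j \<le> p | U \<Rightarrow> 1 - p \<le> x j} \<in> sets (cube d)"
    by (intro sets.sets_Collect_finite_All') (use J assms h in \<open>auto simp: generators_def\<close>)
  then show ?thesis by (simp add: tail_region_def h)
qed

lemma cell_sets:
  assumes "h \<in> generators d" shows "cell d p h \<in> sets (cube d)"
proof -
  obtain I \<sigma> where h: "h = (I, \<sigma>)" by (cases h)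
  have *: "{x \<in> space (cube d). p < x i \<and> x i < 1 - p} \<in> sets (cube d)" if "i \<in> {1..d} - I" for i
    using coord_measurable[of i d] that by auto
  have "{x \<in> space (cube d). \<forall>i\<in>{1..d} - I. p < x i \<and> x i < 1 - p} \<in> sets (cube d)"
    by (intro sets.sets_Collect_finite_All *) auto
  then have "tail_region d p h \<inter> {x \<in> space (cube d). \<forall>i\<in>{1..d} - I. p < x i \<and> x i < 1 - p} \<in> sets (cube d)"
    using tail_region_sets[OF assms] by blast
  also have "tail_region d p h \<inter> {x \<in> space (cube d). \<forall>i\<in>{1..d} - I. p < x i \<and> x i < 1 - p} = cell d p h"
    by (auto simp: cell_def tail_region_def h)
  finally show ?thesis .
qed

lemma cell_disjoint:
  assumes "0 < p" "p < 1/2" "x \<in> cell d p g" "x \<in> cell d p h" "g \<in> generators d" "h \<in> generators d"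
  shows "g = h"
proof -
  obtain I \<sigma> J \<tau> where gh: "g = (I, \<sigma>)" "h = (J, \<tau>)" by (cases g, cases h)
  have s: "I \<subseteq> {1..d}" "J \<subseteq> {1..d}" "\<sigma> \<in> I \<rightarrow>\<^sub>E UNIV" "\<tau> \<in> J \<rightarrow>\<^sub>E UNIV"
    using assms gh by (auto simp: generators_def sign_patterns_def)
  have A: "i \<in> J \<and> \<sigma> i = \<tau> i" if i: "i \<in> I" "x \<in> cell d p (I, \<sigma>)" "x \<in> cell d p (J, \<tau>)"
    "I \<subseteq> {1..d}" for i I J \<sigma> \<tau>
  proof -
    have 1: "case \<sigma> i of L \<Rightarrow> x i \<le> p | U \<Rightarrow> 1 - p \<le> x i"
      using i by (auto simp: cell_def tail_region_def)
    have "i \<in> J"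
    proof (rule ccontr)
      assume "i \<notin> J"
      then have "p < x i \<and> x i < 1 - p" using i by (auto simp: cell_def)
      with 1 show False by (cases "\<sigma> i") auto
    qed
    then have 2: "case \<tau> i of L \<Rightarrow> x i \<le> p | U \<Rightarrow> 1 - p \<le> x i"
      using i by (auto simp: cell_def tail_region_def)
    show ?thesis using 1 2 \<open>i \<in> J\<close> assms(2) by (cases "\<sigma> i"; cases "\<tau> i") auto
  qed
  have "I = J" using A[of _ I \<sigma> J \<tau>] A[of _ J \<tau> I \<sigma>] assms gh s by blast
  moreover have "\<sigma> = \<tau>"
    by (rule PiE_ext[OF s(3)]) (use s \<open>I = J\<close> A[of _ I \<sigma> J \<tau>] assms gh in auto)
  ultimately show ?thesis by (simp add: gh)
qed

text \<open>Every weight system has a realization at every scale: put an atom into each cell.\<close>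

lemma realization_exists:
  assumes p: "0 < p" "p < 1/2" and w: "weight_system d w"
  shows "\<exists>M. realizes d p w M"
proof -
  define pt where "pt = (\<lambda>(I, \<sigma>). restrict (\<lambda>i. if i \<in> I then case \<sigma> i of L \<Rightarrow> 0 | U \<Rightarrow> 1 else 1/2 :: real) {1..d})"
  let ?N = "point_measure (generators d) (\<lambda>g. ennreal (p * w g))"
  define M where "M = distr ?N (cube d) pt"
  have mem: "pt g \<in> cell d p g" if "g \<in> generators d" for g
    using that p by (auto simp: pt_def cell_def tail_region_def space_cube generators_def subset_iff split: side.splits)
  have m: "pt \<in> ?N \<rightarrow>\<^sub>M cube d"
    using mem by (auto simp: measurable_point_measure_eq1 finite_generators cell_def tail_region_def split: prod.splits)
  have e: "emeasure M A = (\<Sum>g | g \<in> generators d \<and> pt g \<in> A. ennreal (p * w g))" if "A \<in> sets (cube d)" for A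
  proof -
    have "emeasure M A = emeasure ?N {g\<in>generators d. pt g \<in> A}"
      unfolding M_def emeasure_distr[OF m that] by (simp add: vimage_def Int_def conj_commute space_point_measure)
    then show ?thesis by (simp add: emeasure_point_measure_finite finite_generators)
  qed
  have "emeasure M (cell d p g) = ennreal (p * w g)" if "g \<in> generators d" for g
  proof -
    have "{h. h \<in> generators d \<and> pt h \<in> cell d p g} = {g}"
      using mem cell_disjoint[OF p] that by blast
    then show ?thesis using e[OF cell_sets[OF that]] by simp
  qed
  then have "\<forall>g\<in>generators d. measure M (cell d p g) = p * w g"
    using w p by (auto simp: measure_def weight_system_def)
  moreover have "finite_measure M"
  proof
    have "space M = space (cube d)" by (simp add: M_def)
    then show "emeasure M (space M) \<noteq> \<infinity>" using e[of "space (cube d)"] by (simp add: finite_generators)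
  qed
  moreover have "sets M = sets (cube d)" by (simp add: M_def)
  ultimately show ?thesis unfolding realizes_def by blast
qed

end

theory Submission imports Defs begin

text \<open>
  A generator \<open>(I, \<sigma>)\<close> contributes to \<open>\<lambda>\<^bsub>J,\<tau>\<^esub>\<close> exactly when \<open>\<sigma>\<close> is an extension of the sign
  pattern \<open>\<tau>\<close> to \<open>I\<close>.  Thus \<open>\<lambda>\<^bsub>J,\<tau>\<^esub>\<close> is the total weight of the extensions of \<open>(J, \<tau>)\<close>
  (\<open>tail_family_eq_sum_extensions\<close>); fibring this set over \<open>I\<close> gives the double sum.  The matrix
  form and linearity hold because the tail family is a finite sum of weights against coefficients
  that do not involve \<open>w\<close>.

  Scale independence is the geometric counterpart.  For \<open>0 < p < 1/2\<close> a point of the cube has, in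
  each coordinate, exactly one of the states lower, upper and central.  Recording the noncentral
  coordinates and their states assigns to the point its cell, and being in the \<open>(J, \<tau>)\<close>-tail means
  that this record extends \<open>(J, \<tau>)\<close>.  Hence the tail region is the disjoint union of the cells of
  the extensions of \<open>(J, \<tau>)\<close> (\<open>tail_region_eq_Union_cells\<close>).  The central box is disjoint from the
  tail because \<open>J\<close> is nonempty, so its mass, which a realization leaves free, does not enter.
  Every cell has mass \<open>p\<close> times its weight, so the tail mass is \<open>p \<lambda>\<^bsub>J,\<tau>\<^esub>\<close> and the factor \<open>p\<close>
  cancels.
\<close>

definition extensions :: "nat \<Rightarrow> gen \<Rightarrow> gen set" where
  "extensions d = (\<lambda>(J, \<tau>).
     SIGMA I : {I. J \<subseteq> I \<and> I \<subseteq> {1..d}}. {\<sigma> \<in> sign_patterns I. restrict \<sigma> J = \<tau>})"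

text \<open>Nonemptiness of \<open>J\<close> is what excludes the empty index set, which is not a generator.\<close>

lemma extensions_eq_filter_generators:
  assumes "(J, \<tau>) \<in> generators d"
  shows "extensions d (J, \<tau>) = {(I, \<sigma>) \<in> generators d. J \<subseteq> I \<and> restrict \<sigma> J = \<tau>}"
  using assms by (auto simp: extensions_def generators_def)

lemma extensions_subset_generators:
  assumes "h \<in> generators d"
  shows "extensions d h \<subseteq> generators d"
  using assms by (cases h) (auto simp: extensions_eq_filter_generators)

lemma finite_extensions:
  assumes "h \<in> generators d"
  shows "finite (extensions d h)"
  using finite_subset[OF extensions_subset_generators[OF assms] finite_generators] .

lemma tail_family_eq_sum_extensions:
  assumes "h \<in> generators d"
  shows "tail_family d w h = (\<Sum>g\<in>extensions d h. w g)"
proof -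
  obtain J \<tau> where h: "h = (J, \<tau>)" by (cases h)
  have "tail_family d w h = (\<Sum>g\<in>extensions d h. w g * signature g h)"
    unfolding tail_family_def
    by (rule sum.mono_neutral_right[OF finite_generators extensions_subset_generators[OF assms]])
       (use assms in \<open>auto simp: h extensions_eq_filter_generators signature_def\<close>)
  also have "\<dots> = (\<Sum>g\<in>extensions d h. w g)"
    by (rule sum.cong) (use assms in \<open>auto simp: h extensions_eq_filter_generators signature_def\<close>)
  finally show ?thesis .
qed

lemma tail_family_eq_double_sum:
  assumes "(J, \<tau>) \<in> generators d"
  shows "tail_family d w (J, \<tau>) =
    (\<Sum>I | J \<subseteq> I \<and> I \<subseteq> {1..d}. \<Sum>\<sigma> | \<sigma> \<in> sign_patterns I \<and> restrict \<sigma> J = \<tau>. w (I, \<sigma>))"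
proof -
  have fin_I: "finite {I. J \<subseteq> I \<and> I \<subseteq> {1..d}}"
    by (rule finite_subset[of _ "Pow {1..d}"]) auto
  have fin_\<sigma>: "finite {\<sigma> \<in> sign_patterns I. restrict \<sigma> J = \<tau>}" if "J \<subseteq> I" "I \<subseteq> {1..d}" for I
  proof -
    have "Pair I ` {\<sigma> \<in> sign_patterns I. restrict \<sigma> J = \<tau>} \<subseteq> extensions d (J, \<tau>)"
      using that by (auto simp: extensions_def)
    then have "finite (Pair I ` {\<sigma> \<in> sign_patterns I. restrict \<sigma> J = \<tau>})"
      by (rule finite_subset[OF _ finite_extensions[OF assms]])
    then show ?thesis
      by (rule finite_imageD) (simp add: inj_on_def)
  qed
  show ?thesis
    unfolding tail_family_eq_sum_extensions[OF assms] extensions_def prod.case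
    by (subst sum.Sigma[OF fin_I]) (simp_all add: fin_\<sigma>)
qed

lemma tail_family_eq_mat_vec: "tail_family d w = mat_vec d incidence_matrix w"
  by (simp add: tail_family_def mat_vec_def signature_def incidence_matrix_def split_def
      mult.commute)

lemma linear_tail_family:
  "Vector_Spaces.linear (\<lambda>c f g. c * f g) (\<lambda>c f g. c * f g) (tail_family d)"
  by unfold_locales
     (auto simp: tail_family_def fun_eq_iff algebra_simps sum.distrib sum_distrib_left)

text \<open>
  The index set consists of all coordinates of \<open>x\<close> that are outside the central range, which
  contains \<open>J\<close>.  On \<open>J\<close> the recorded pattern can only be \<open>\<tau>\<close>, since \<open>p < 1/2\<close> keeps the lower
  range below the upper one.
\<close>

lemma tail_point_in_cell_of_extension:
  assumes p: "0 < p" "p < 1 / 2" and h: "h \<in> generators d" and x: "x \<in> tail_region d p h"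
  obtains g where "g \<in> extensions d h" "x \<in> cell d p g"
proof -
  obtain J \<tau> where h_eq: "h = (J, \<tau>)" by (cases h)
  have J: "J \<subseteq> {1..d}" and \<tau>: "\<tau> \<in> J \<rightarrow>\<^sub>E UNIV"
    using h by (auto simp: h_eq generators_def sign_patterns_def)
  define I where "I = {i \<in> {1..d}. x i \<le> p \<or> 1 - p \<le> x i}"
  define \<sigma> where "\<sigma> = (\<lambda>i\<in>I. if x i \<le> p then L else U)"
  have tail: "case \<tau> j of L \<Rightarrow> x j \<le> p | U \<Rightarrow> 1 - p \<le> x j" if "j \<in> J" for j
    using x that by (auto simp: h_eq tail_region_def)
  have on_J: "j \<in> I \<and> \<sigma> j = \<tau> j" if "j \<in> J" for j
    using tail[OF that] J that p by (cases "\<tau> j") (auto simp: I_def \<sigma>_def)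
  have "restrict \<sigma> J = \<tau>"
    by (rule PiE_ext[OF _ \<tau>]) (use on_J in auto)
  then have "(I, \<sigma>) \<in> extensions d h"
    using on_J by (auto simp: h_eq extensions_def sign_patterns_def I_def \<sigma>_def)
  moreover have "x \<in> cell d p (I, \<sigma>)"
    using x by (auto simp: h_eq cell_def tail_region_def I_def \<sigma>_def)
  ultimately show ?thesis by (rule that)
qed

lemma cell_extension_subset_tail_region:
  assumes "g \<in> extensions d h"
  shows "cell d p g \<subseteq> tail_region d p h"
proof -
  obtain I \<sigma> J \<tau> where gh: "g = (I, \<sigma>)" "h = (J, \<tau>)" by (cases g, cases h)
  then have "J \<subseteq> I" and "\<tau> = restrict \<sigma> J"
    using assms by (auto simp: extensions_def)
  then show ?thesis
    by (auto simp: gh cell_def tail_region_def)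
qed

lemma tail_region_eq_Union_cells:
  assumes "0 < p" "p < 1 / 2" "h \<in> generators d"
  shows "tail_region d p h = (\<Union>g\<in>extensions d h. cell d p g)"
proof
  show "tail_region d p h \<subseteq> (\<Union>g\<in>extensions d h. cell d p g)"
  proof
    fix x assume "x \<in> tail_region d p h"
    then obtain g where "g \<in> extensions d h" "x \<in> cell d p g"
      by (rule tail_point_in_cell_of_extension[OF assms])
    then show "x \<in> (\<Union>g\<in>extensions d h. cell d p g)" ..
  qed
  show "(\<Union>g\<in>extensions d h. cell d p g) \<subseteq> tail_region d p h"
    by (intro UN_least cell_extension_subset_tail_region)
qed

lemma realized_tail_mass:
  assumes p: "0 < p" "p < 1 / 2" and M: "realizes d p w M" and h: "h \<in> generators d"
  shows "measure M (tail_region d p h) = p * tail_family d w h"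
proof -
  interpret finite_measure M using M by (simp add: realizes_def)
  note ext = extensions_subset_generators[OF h]
  have "measure M (tail_region d p h) = (\<Sum>g\<in>extensions d h. measure M (cell d p g))"
    unfolding tail_region_eq_Union_cells[OF p h]
  proof (rule finite_measure_finite_Union[OF finite_extensions[OF h]])
    show "cell d p ` extensions d h \<subseteq> sets M"
      using M ext cell_sets by (auto simp: realizes_def)
    show "disjoint_family_on (cell d p) (extensions d h)"
      unfolding disjoint_family_on_def using cell_disjoint[OF p] ext by blast
  qed
  also have "\<dots> = (\<Sum>g\<in>extensions d h. p * w g)"
    using M ext by (intro sum.cong) (auto simp: realizes_def)
  also have "\<dots> = p * tail_family d w h"
    by (simp add: tail_family_eq_sum_extensions[OF h] sum_distrib_left)
  finally show ?thesis .
qed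

theorem theorem1:
  fixes d :: nat and w :: "gen \<Rightarrow> real"
  assumes "d \<ge> 1" and "weight_system d w"
  shows
    "(\<forall>(J, \<tau>)\<in>generators d.
        tail_family d w (J, \<tau>) =
          (\<Sum>I | J \<subseteq> I \<and> I \<subseteq> {1..d}.
             \<Sum>\<sigma> | \<sigma> \<in> sign_patterns I \<and> restrict \<sigma> J = \<tau>. w (I, \<sigma>)))
     \<and> (\<forall>h\<in>generators d. tail_family d w h = mat_vec d incidence_matrix w h)
     \<and> Vector_Spaces.linear (\<lambda>c f g. c * f g) (\<lambda>c f g. c * f g) (tail_family d)
     \<and> (\<forall>p\<^sub>0. 0 < p\<^sub>0 \<and> p\<^sub>0 < 1 / 2 \<longrightarrow>
          (\<forall>M. realizes d p\<^sub>0 w M \<longrightarrow>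
             (\<forall>h\<in>generators d. measure M (tail_region d p\<^sub>0 h) / p\<^sub>0 = tail_family d w h)))"
proof (intro conjI ballI allI impI)
  fix h assume "h \<in> generators d"
  then show "case h of (J, \<tau>) \<Rightarrow> tail_family d w (J, \<tau>) =
      (\<Sum>I | J \<subseteq> I \<and> I \<subseteq> {1..d}.
         \<Sum>\<sigma> | \<sigma> \<in> sign_patterns I \<and> restrict \<sigma> J = \<tau>. w (I, \<sigma>))"
    by (cases h) (simp only: prod.case tail_family_eq_double_sum)
next
  show "tail_family d w h = mat_vec d incidence_matrix w h" for h
    by (simp only: tail_family_eq_mat_vec)
next
  show "Vector_Spaces.linear (\<lambda>c f g. c * f g) (\<lambda>c f g. c * f g) (tail_family d)"
    by (rule linear_tail_family)
next
  fix p M h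
  assume "0 < p \<and> p < 1 / 2" "realizes d p w M" "h \<in> generators d"
  then show "measure M (tail_region d p h) / p = tail_family d w h"
    by (simp add: realized_tail_mass)
qed

end
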